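(* Assume $\kappa>0$, $\phi_*:=\inf_{r\ge0}\phi(r)>0$ and $\phi_*M>\sigma\bar\theta$. Then for every solution of system (CSF), $\mathcal A(t):=\max_{i,j}|\mathbf v_i(t)-\mathbf v_j(t)|\to0$ exponentially fast, and exactly one of the following holds: either $\mathbf v_i(t)\to0$ for all $i$, or there exists a vector $\bar{\mathbf v}\in\mathbb R^n$ with $|\bar{\mathbf v}|=\bar\theta^{1/p}$ such that all $\mathbf v_i(t)$ converge to $\bar{\mathbf v}$ exponentially fast.
   Context: Fix integers $N\ge1$, $n\ge1$, masses $m_1,\dots,m_N>0$ with $M=\sum_i m_i$, parameters $\sigma>0$, $p>0$, $\kappa\ge0$, and a communication kernel $\phi:[0,\infty)\to(0,\infty)$ that is smooth, positive and non-increasing. Write $\phi_{ij}=\phi(|\mathbf x_i-\mathbf x_j|)$, with $|\cdot|$ the Euclidean norm on $\mathbb R^n$. System (CSF) is, for $i=1,\dots,N$, $$\dot{\mathbf x}_i=\mathbf v_i,\qquad \dot{\mathbf v}_i=\sum_{j=1}^N m_j\phi_{ij}(\mathbf v_j-\mathbf v_i)+\sigma(\theta_i-|\mathbf v_i|^p)\mathbf v_i,\qquad \dot\theta_i=\kappa\sum_{j=1}^N m_j\phi_{ij}(\theta_j-\theta_i),$$ with $\mathbf x_i,\mathbf v_i\in\mathbb R^n$ and initial values $\theta_i(0)>0$; solutions are considered for $t\ge0$. Set $\bar\theta=\frac1M\sum_i m_i\theta_i(0)$; this weighted average is conserved in time. *)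

theory Defs
  imports "HOL-Analysis.Analysis"
begin

definition smooth_on :: "real set \<Rightarrow> (real \<Rightarrow> real) \<Rightarrow> bool" where
  "smooth_on S f \<longleftrightarrow> (\<exists>D :: nat \<Rightarrow> real \<Rightarrow> real.
      (\<forall>x\<in>S. D 0 x = f x) \<and>
      (\<forall>k. \<forall>x\<in>S. (D k has_real_derivative D (Suc k) x) (at x within S)))"

definition comm_kernel :: "(real \<Rightarrow> real) \<Rightarrow> bool" where
  "comm_kernel \<phi> \<longleftrightarrow> smooth_on {0..} \<phi> \<and> (\<forall>r\<ge>0. \<phi> r > 0) \<and>
     (\<forall>r s. 0 \<le> r \<longrightarrow> r \<le> s \<longrightarrow> \<phi> s \<le> \<phi> r)"

definition CSF_solution ::
  "nat \<Rightarrow> (nat \<Rightarrow> real) \<Rightarrow> real \<Rightarrow> real \<Rightarrow> real \<Rightarrow> (real \<Rightarrow> real)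
   \<Rightarrow> (nat \<Rightarrow> real \<Rightarrow> real ^ 'n) \<Rightarrow> (nat \<Rightarrow> real \<Rightarrow> real ^ 'n) \<Rightarrow> (nat \<Rightarrow> real \<Rightarrow> real) \<Rightarrow> bool"
  where
  "CSF_solution N m \<sigma> p \<kappa> \<phi> x v \<theta> \<longleftrightarrow>
     (\<forall>i<N. \<forall>t\<ge>0.
        (x i has_vector_derivative v i t) (at t within {0..}) \<and>
        (v i has_vector_derivative
           ((\<Sum>j<N. (m j * \<phi> (norm (x i t - x j t))) *\<^sub>R (v j t - v i t))
            + (\<sigma> * (\<theta> i t - norm (v i t) powr p)) *\<^sub>R v i t)) (at t within {0..}) \<and>
        (\<theta> i has_real_derivative
           (\<kappa> * (\<Sum>j<N. m j * \<phi> (norm (x i t - x j t)) * (\<theta> j t - \<theta> i t)))) (at t within {0..}))"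

end

theory Submission
  imports Defs
begin

text \<open>
  Symmetry of the coupling conserves the mean of the \<open>\<theta>\<^sub>i\<close> and makes their variance decay
  exponentially; superquadratic damping then keeps the kinetic energy bounded. In the equation for
  the variance of the velocities the field \<open>a \<mapsto> |a|\<^sup>p a\<close> is monotone and can be discarded, so
  under strong coupling the velocities align exponentially fast. Their mean \<open>u\<close> consequently solves
  \<open>u' = \<sigma> (\<theta> - |u|\<^sup>p) u + R\<close> with \<open>R\<close> exponentially small. If \<open>u\<close> does not tend to 0, it is
  eventually trapped outside a small ball, on whose boundary the Rayleigh field points outwards and
  dominates \<open>R\<close>. From then on \<open>|u|\<^sup>p\<close> solves a perturbed logistic equation away from its unstable
  equilibrium, so it converges to \<open>\<theta>\<close> exponentially fast; then \<open>u'\<close> decays exponentially and \<open>u\<close>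
  converges.
\<close>

section \<open>Exponential decay\<close>

definition exp_decay :: "(real \<Rightarrow> 'a::real_normed_vector) \<Rightarrow> bool" where
  "exp_decay f \<longleftrightarrow> (\<exists>C r. r > 0 \<and> (\<forall>\<^sub>F t in at_top. norm (f t) \<le> C * exp (- r * t)))"

lemma exp_decayI:
  assumes "r > 0" "\<forall>\<^sub>F t in at_top. norm (f t) \<le> C * exp (- r * t)"
  shows "exp_decay f"
  using assms unfolding exp_decay_def by blast

lemma exp_decayE:
  assumes "exp_decay f"
  obtains C r where "C > 0" "r > 0" "\<forall>\<^sub>F t in at_top. norm (f t) \<le> C * exp (- r * t)"
proof -
  from assms obtain C r where r: "r > 0" and bound: "\<forall>\<^sub>F t in at_top. norm (f t) \<le> C * exp (- r * t)"
    unfolding exp_decay_def by blast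
  have "\<forall>\<^sub>F t in at_top. norm (f t) \<le> (\<bar>C\<bar> + 1) * exp (- r * t)"
    using bound by eventually_elim (erule order_trans, auto intro!: mult_right_mono)
  then show thesis using that[of "\<bar>C\<bar> + 1" r] r by simp
qed

lemma tendsto_exp_neg_at_top:
  assumes "r > 0"
  shows "((\<lambda>t::real. C * exp (- r * t)) \<longlongrightarrow> 0) at_top"
proof -
  have "filterlim (\<lambda>t. - r * t) at_bot at_top"
    using assms
    by (intro filterlim_tendsto_neg_mult_at_bot[OF tendsto_const _ filterlim_ident]) auto
  then have "((\<lambda>t. exp (- r * t)) \<longlongrightarrow> 0) at_top"
    by (rule filterlim_compose[OF exp_at_bot])
  then show ?thesis by (rule tendsto_mult_right_zero)
qed

lemma exp_decay_tendsto_0: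
  assumes "exp_decay f"
  shows "(f \<longlongrightarrow> 0) at_top"
  using assms by (rule exp_decayE) (erule Lim_null_comparison, erule tendsto_exp_neg_at_top)

lemma exp_decay_dominated:
  assumes "exp_decay g" and dominated: "\<forall>\<^sub>F t in at_top. norm (f t) \<le> K * norm (g t)"
  shows "exp_decay f"
proof -
  obtain C r where "r > 0" and bound: "\<forall>\<^sub>F t in at_top. norm (g t) \<le> C * exp (- r * t)"
    using exp_decayE[OF assms(1)] by blast
  from dominated bound have "\<forall>\<^sub>F t in at_top. norm (f t) \<le> (\<bar>K\<bar> * C) * exp (- r * t)"
  proof eventually_elim
    case (elim t)
    have "K * norm (g t) \<le> \<bar>K\<bar> * norm (g t)" by (intro mult_right_mono) auto
    also have "\<dots> \<le> \<bar>K\<bar> * (C * exp (- r * t))" using elim by (intro mult_left_mono) auto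
    finally show ?case using elim by (simp add: mult.assoc)
  qed
  with \<open>r > 0\<close> show ?thesis by (rule exp_decayI)
qed

lemma exp_decay_norm_iff: "exp_decay (\<lambda>t. norm (f t)) \<longleftrightarrow> exp_decay f"
  by (simp add: exp_decay_def)

lemma exp_decay_zero: "exp_decay (\<lambda>t. 0)"
  by (rule exp_decayI[of 1 _ 0]) auto

lemma exp_decay_add:
  assumes "exp_decay f" "exp_decay g"
  shows "exp_decay (\<lambda>t. f t + g t)"
proof -
  obtain C r where "C > 0" "r > 0" and f_le: "\<forall>\<^sub>F t in at_top. norm (f t) \<le> C * exp (- r * t)"
    using exp_decayE[OF assms(1)] by blast
  obtain D s where "D > 0" "s > 0" and g_le: "\<forall>\<^sub>F t in at_top. norm (g t) \<le> D * exp (- s * t)"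
    using exp_decayE[OF assms(2)] by blast
  from f_le g_le eventually_ge_at_top[of 0]
  have "\<forall>\<^sub>F t in at_top. norm (f t + g t) \<le> (C + D) * exp (- min r s * t)"
  proof eventually_elim
    case (elim t)
    have "C * exp (- r * t) \<le> C * exp (- min r s * t)" "D * exp (- s * t) \<le> D * exp (- min r s * t)"
      using \<open>C > 0\<close> \<open>D > 0\<close> elim by (auto intro!: mult_left_mono mult_right_mono)
    then show ?case
      using norm_triangle_ineq[of "f t" "g t"] elim by (simp add: distrib_right)
  qed
  with \<open>r > 0\<close> \<open>s > 0\<close> show ?thesis by (intro exp_decayI[of "min r s"]) auto
qed

lemma exp_decay_sum:
  assumes "\<And>i. i \<in> A \<Longrightarrow> exp_decay (f i)"
  shows "exp_decay (\<lambda>t. \<Sum>i\<in>A. f i t)"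
  using assms
  by (induction A rule: infinite_finite_induct) (auto intro: exp_decay_zero exp_decay_add)

lemma (in bounded_bilinear) exp_decay_prod_left:
  assumes f: "exp_decay f" and g: "Bfun g at_top"
  shows "exp_decay (\<lambda>t. prod (f t) (g t))"
proof -
  obtain K where K: "K \<ge> 0" "\<And>a b. norm (prod a b) \<le> norm a * norm b * K"
    using nonneg_bounded by blast
  obtain B where "B > 0" and B: "\<forall>\<^sub>F t in at_top. norm (g t) \<le> B"
    using g by (rule BfunE)
  from B have "\<forall>\<^sub>F t in at_top. norm (prod (f t) (g t)) \<le> (B * K) * norm (f t)"
  proof eventually_elim
    case (elim t)
    have "norm (prod (f t) (g t)) \<le> norm (f t) * norm (g t) * K" by (rule K)
    also have "\<dots> \<le> norm (f t) * B * K" using elim K by (intro mult_right_mono mult_left_mono) auto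
    finally show ?case by (simp add: mult_ac)
  qed
  with f show ?thesis by (rule exp_decay_dominated)
qed

lemma (in bounded_bilinear) exp_decay_prod_right:
  assumes "Bfun f at_top" "exp_decay g"
  shows "exp_decay (\<lambda>t. prod (f t) (g t))"
  using bounded_bilinear.exp_decay_prod_left[OF flip assms(2,1)] .

lemma exp_decay_scaleR:
  assumes "exp_decay f"
  shows "exp_decay (\<lambda>t. c *\<^sub>R f t)"
  by (rule bounded_bilinear.exp_decay_prod_right[OF bounded_bilinear_scaleR Bfun_const assms])

lemma exp_decay_diff:
  assumes "exp_decay f" "exp_decay g"
  shows "exp_decay (\<lambda>t. f t - g t)"
  using exp_decay_add[OF assms(1) exp_decay_scaleR[OF assms(2), of "-1"]] by simp

lemma exp_decay_norm_power2_iff: "exp_decay (\<lambda>t. (norm (f t))\<^sup>2) \<longleftrightarrow> exp_decay f"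
proof
  assume "exp_decay (\<lambda>t. (norm (f t))\<^sup>2)"
  then obtain C r where "C > 0" "r > 0"
    and bound: "\<forall>\<^sub>F t in at_top. norm ((norm (f t))\<^sup>2) \<le> C * exp (- r * t)"
    by (rule exp_decayE)
  from bound have "\<forall>\<^sub>F t in at_top. norm (f t) \<le> sqrt C * exp (- (r/2) * t)"
  proof eventually_elim
    case (elim t)
    have "(norm (f t))\<^sup>2 \<le> C * exp (- r * t)" using elim by simp
    also have "\<dots> = (sqrt C * exp (- (r/2) * t))\<^sup>2"
      using \<open>C > 0\<close> by (simp add: power_mult_distrib flip: exp_double)
    finally show ?case by (rule power2_le_imp_le) (use \<open>C > 0\<close> in simp)
  qed
  with \<open>r > 0\<close> show "exp_decay f" by (intro exp_decayI[of "r/2"]) auto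
next
  assume f: "exp_decay f"
  then obtain C r where "C > 0" "r > 0" and bound: "\<forall>\<^sub>F t in at_top. norm (f t) \<le> C * exp (- r * t)"
    by (rule exp_decayE)
  from bound have "\<forall>\<^sub>F t in at_top. norm ((norm (f t))\<^sup>2) \<le> C\<^sup>2 * exp (- (2 * r) * t)"
  proof eventually_elim
    case (elim t)
    then have "(norm (f t))\<^sup>2 \<le> (C * exp (- r * t))\<^sup>2" by (intro power_mono) auto
    then show ?case by (simp add: power_mult_distrib mult.assoc flip: exp_double)
  qed
  with \<open>r > 0\<close> show "exp_decay (\<lambda>t. (norm (f t))\<^sup>2)" by (intro exp_decayI[of "2 * r"]) auto
qed

lemma exp_decay_bound_from_0:
  assumes "exp_decay f" and cont: "continuous_on {0..} f"
  obtains r C where "r > 0" "\<And>t. t \<ge> 0 \<Longrightarrow> norm (f t) \<le> C * exp (- r * t)"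
proof -
  obtain C r where "C > 0" "r > 0" "\<forall>\<^sub>F t in at_top. norm (f t) \<le> C * exp (- r * t)"
    using assms(1) by (rule exp_decayE)
  then obtain T where f_tail: "\<And>t. t \<ge> T \<Longrightarrow> norm (f t) \<le> C * exp (- r * t)"
    by (auto simp: eventually_at_top_linorder)
  have "bounded (f ` {0..T})"
    by (intro compact_imp_bounded compact_continuous_image)
      (auto intro: continuous_on_subset[OF cont])
  then obtain B where "B > 0" and f_le: "\<And>t. t \<in> {0..T} \<Longrightarrow> norm (f t) \<le> B"
    unfolding bounded_pos by auto
  have "norm (f t) \<le> (C + B * exp (r * T)) * exp (- r * t)" if "t \<ge> 0" for t
  proof (cases "t \<le> T")
    case True
    have "norm (f t) \<le> B * 1" using f_le that True by auto
    also have "\<dots> \<le> B * exp (r * T - r * t)"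
      using \<open>B > 0\<close> True \<open>r > 0\<close> by (intro mult_left_mono) auto
    also have "\<dots> = (B * exp (r * T)) * exp (- r * t)" by (simp add: exp_diff exp_minus field_simps)
    also have "\<dots> \<le> (C + B * exp (r * T)) * exp (- r * t)"
      using \<open>C > 0\<close> by (intro mult_right_mono) auto
    finally show ?thesis .
  next
    case False
    then have "norm (f t) \<le> C * exp (- r * t)" using f_tail by simp
    also have "\<dots> \<le> (C + B * exp (r * T)) * exp (- r * t)"
      using \<open>B > 0\<close> by (intro mult_right_mono) auto
    finally show ?thesis .
  qed
  with \<open>r > 0\<close> show thesis by (rule that)
qed

lemma exp_decay_uniform_iff:
  assumes "finite A" and cont: "\<And>i. i \<in> A \<Longrightarrow> continuous_on {0..} (f i)"
  shows "(\<forall>i\<in>A. exp_decay (f i)) \<longleftrightarrow>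
    (\<exists>C r. r > 0 \<and> (\<forall>i\<in>A. \<forall>t\<ge>0. norm (f i t) \<le> C * exp (- r * t)))"
proof
  assume "\<forall>i\<in>A. exp_decay (f i)"
  then have "exp_decay (\<lambda>t. \<Sum>i\<in>A. norm (f i t))"
    by (intro exp_decay_sum) (simp add: exp_decay_norm_iff)
  moreover have "continuous_on {0..} (\<lambda>t. \<Sum>i\<in>A. norm (f i t))"
    by (intro continuous_on_sum continuous_on_norm cont)
  ultimately obtain r C where "r > 0"
    and sum_le: "\<And>t. t \<ge> 0 \<Longrightarrow> norm (\<Sum>i\<in>A. norm (f i t)) \<le> C * exp (- r * t)"
    by (rule exp_decay_bound_from_0) blast
  have "norm (f i t) \<le> C * exp (- r * t)" if "i \<in> A" "t \<ge> 0" for i t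
    using member_le_sum[of i A "\<lambda>i. norm (f i t)"] sum_le[of t] that \<open>finite A\<close> by simp
  with \<open>r > 0\<close> show "\<exists>C r. r > 0 \<and> (\<forall>i\<in>A. \<forall>t\<ge>0. norm (f i t) \<le> C * exp (- r * t))" by blast
next
  assume "\<exists>C r. r > 0 \<and> (\<forall>i\<in>A. \<forall>t\<ge>0. norm (f i t) \<le> C * exp (- r * t))"
  then show "\<forall>i\<in>A. exp_decay (f i)"
    unfolding exp_decay_def eventually_at_top_linorder by meson
qed

section \<open>Derivatives and differential inequalities\<close>

lemma has_real_derivative_norm_power2:
  fixes f :: "real \<Rightarrow> 'a::real_inner"
  assumes "(f has_vector_derivative f') (at t within S)"
  shows "((\<lambda>t. (norm (f t))\<^sup>2) has_real_derivative 2 * inner (f t) f') (at t within S)"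
  unfolding power2_norm_eq_inner
  using assms unfolding has_vector_derivative_def has_field_derivative_def
  by (auto intro!: derivative_eq_intros simp: fun_eq_iff inner_commute algebra_simps)

lemma has_real_derivative_norm_powr:
  fixes f :: "real \<Rightarrow> 'a::real_inner"
  assumes "(f has_vector_derivative f') (at t within S)" "f t \<noteq> 0"
  shows "((\<lambda>t. norm (f t) powr p) has_real_derivative p * norm (f t) powr (p - 2) * inner (f t) f')
    (at t within S)"
proof -
  have powr_half: "norm a powr q = ((norm a)\<^sup>2) powr (q / 2)" for a :: 'a and q
    by (cases "a = 0") (auto simp: powr_powr simp flip: powr_numeral)
  have "((\<lambda>t. ((norm (f t))\<^sup>2) powr (p/2)) has_real_derivative
      (p/2) * ((norm (f t))\<^sup>2) powr (p/2 - 1) * (2 * inner (f t) f')) (at t within S)"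
    using assms
    by (intro DERIV_chain2[OF has_real_derivative_powr has_real_derivative_norm_power2]) auto
  then show ?thesis
    unfolding powr_half[of _ p] powr_half[of _ "p - 2"]
    by (simp add: diff_divide_distrib mult.assoc)
qed

lemma eventually_has_vector_derivative_at:
  assumes "\<And>t. t \<ge> 0 \<Longrightarrow> (f has_vector_derivative f' t) (at t within {0..})"
  shows "\<forall>\<^sub>F t in at_top. (f has_vector_derivative f' t) (at t)"
  using eventually_gt_at_top[of 0]
proof eventually_elim
  case (elim t)
  then have "at t within {0..} = at t" by (intro at_within_interior) simp
  then show ?case using assms[of t] elim by simp
qed

lemma gronwall_exp:
  fixes f :: "real \<Rightarrow> real"
  assumes "b < a"
    and "\<forall>\<^sub>F t in at_top. (f has_real_derivative f' t) (at t)"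
    and "\<forall>\<^sub>F t in at_top. f' t \<le> - a * f t + C * exp (- b * t)"
  obtains D where "\<forall>\<^sub>F t in at_top. f t \<le> D * exp (- b * t)"
proof -
  from eventually_conj[OF assms(2,3)]
  obtain T where deriv: "\<And>t. t \<ge> T \<Longrightarrow> (f has_real_derivative f' t) (at t)"
    and f'_le: "\<And>t. t \<ge> T \<Longrightarrow> f' t \<le> - a * f t + C * exp (- b * t)"
    by (auto simp: eventually_at_top_linorder)
  define g where "g t = exp (a * t) * f t - C / (a - b) * exp ((a - b) * t)" for t
  have g_deriv: "(g has_real_derivative exp (a * t) * (f' t + a * f t - C * exp (- b * t))) (at t)"
    if "t \<ge> T" for t
    unfolding g_def using \<open>b < a\<close>
    by (auto intro!: derivative_eq_intros deriv[OF that])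
      (auto simp: field_simps simp flip: exp_add)
  have g_le: "g t \<le> g T" if "t \<ge> T" for t
    using that
  proof (rule DERIV_nonpos_imp_nonincreasing)
    fix s assume "T \<le> s"
    then have "exp (a * s) * (f' s + a * f s - C * exp (- b * s)) \<le> 0"
      using f'_le[of s] by (intro mult_nonneg_nonpos) auto
    then show "\<exists>y. DERIV g s :> y \<and> y \<le> 0" using g_deriv[OF \<open>T \<le> s\<close>] by blast
  qed
  have "f t \<le> (\<bar>g T\<bar> + C / (a - b)) * exp (- b * t)" if "t \<ge> max T 0" for t
  proof -
    have "f t = exp (- a * t) * g t + C / (a - b) * exp (- b * t)"
      unfolding g_def by (simp add: algebra_simps flip: exp_add)
    also have "exp (- a * t) * g t \<le> exp (- a * t) * \<bar>g T\<bar>"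
      using g_le[of t] that by (intro mult_left_mono) auto
    also have "\<dots> \<le> exp (- b * t) * \<bar>g T\<bar>"
      using that \<open>b < a\<close> by (auto intro!: mult_right_mono)
    finally show ?thesis by (simp add: algebra_simps)
  qed
  then show thesis using that eventually_at_top_linorder by blast
qed

lemma Bfun_gronwall:
  fixes f :: "real \<Rightarrow> real"
  assumes "a > 0" and nonneg: "\<forall>\<^sub>F t in at_top. 0 \<le> f t"
    and "\<forall>\<^sub>F t in at_top. (f has_real_derivative f' t) (at t)"
    and "\<forall>\<^sub>F t in at_top. f' t \<le> - a * f t + K"
  shows "Bfun f at_top"
proof -
  obtain D where "\<forall>\<^sub>F t in at_top. f t \<le> D * exp (- 0 * t)"
    using gronwall_exp[of 0 a f f' K] assms by auto
  with nonneg have "\<forall>\<^sub>F t in at_top. norm (f t) \<le> D" by eventually_elim simp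
  then show ?thesis by (rule BfunI)
qed

lemma exp_decay_gronwall:
  fixes f :: "real \<Rightarrow> real"
  assumes "a > 0" and nonneg: "\<forall>\<^sub>F t in at_top. 0 \<le> f t"
    and deriv: "\<forall>\<^sub>F t in at_top. (f has_real_derivative f' t) (at t)"
    and f'_le: "\<forall>\<^sub>F t in at_top. f' t \<le> - a * f t + h t" and "exp_decay h"
  shows "exp_decay f"
proof -
  obtain C r where "C > 0" "r > 0" and h_le: "\<forall>\<^sub>F t in at_top. norm (h t) \<le> C * exp (- r * t)"
    using \<open>exp_decay h\<close> by (rule exp_decayE)
  define b where "b = min r (a/2)"
  have b_bounds: "0 < b" "b < a" "b \<le> r" using \<open>a > 0\<close> \<open>r > 0\<close> by (auto simp: b_def)
  from f'_le h_le eventually_ge_at_top[of 0]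
  have "\<forall>\<^sub>F t in at_top. f' t \<le> - a * f t + C * exp (- b * t)"
  proof eventually_elim
    case (elim t)
    have "C * exp (- r * t) \<le> C * exp (- b * t)"
      using \<open>C > 0\<close> b_bounds elim by (auto intro!: mult_left_mono mult_right_mono)
    then show ?case using elim by simp
  qed
  with \<open>b < a\<close> deriv obtain D where "\<forall>\<^sub>F t in at_top. f t \<le> D * exp (- b * t)"
    by (rule gronwall_exp)
  with nonneg have "\<forall>\<^sub>F t in at_top. norm (f t) \<le> D * exp (- b * t)" by eventually_elim simp
  with \<open>0 < b\<close> show ?thesis by (rule exp_decayI)
qed

lemma norm_increment_le_exp:
  fixes f :: "real \<Rightarrow> 'a::banach"
  assumes "r > 0" "C \<ge> 0" "s \<le> t"
    and deriv: "\<And>\<tau>. \<tau> \<ge> s \<Longrightarrow> (f has_vector_derivative f' \<tau>) (at \<tau>)"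
    and f'_le: "\<And>\<tau>. \<tau> \<ge> s \<Longrightarrow> norm (f' \<tau>) \<le> C * exp (- r * \<tau>)"
  shows "norm (f t - f s) \<le> C / r * exp (- r * s)"
proof (cases "s = t")
  case False
  define \<Phi> where "\<Phi> \<tau> = - C / r * exp (- r * \<tau>)" for \<tau>
  have \<Phi>_deriv: "(\<Phi> has_vector_derivative C * exp (- r * \<tau>)) (at \<tau>)" for \<tau>
    unfolding \<Phi>_def has_real_derivative_iff_has_vector_derivative[symmetric]
    using \<open>r > 0\<close> by (auto intro!: derivative_eq_intros simp: field_simps)
  have "norm (f t - f s) \<le> \<Phi> t - \<Phi> s"
  proof (rule differentiable_bound_general)
    show "s < t" using \<open>s \<le> t\<close> False by simp
    show "continuous_on {s..t} f"
      using deriv by (intro continuous_at_imp_continuous_on ballI)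
        (auto intro: has_vector_derivative_continuous)
    show "continuous_on {s..t} \<Phi>" unfolding \<Phi>_def by (intro continuous_intros)
  qed (auto intro: deriv \<Phi>_deriv f'_le)
  also have "\<dots> \<le> C / r * exp (- r * s)" using assms(1,2) by (simp add: \<Phi>_def)
  finally show ?thesis .
qed (use assms in auto)

lemma tail_bound_imp_limit_at_top:
  fixes f :: "real \<Rightarrow> 'a::complete_space" and g :: "real \<Rightarrow> real"
  assumes tail: "\<And>s t. T \<le> s \<Longrightarrow> s \<le> t \<Longrightarrow> dist (f t) (f s) \<le> g s"
    and "(g \<longlongrightarrow> 0) at_top"
  obtains l where "\<forall>s\<ge>T. dist (f s) l \<le> g s"
proof -
  have "cauchy_filter (filtermap f at_top)"
    unfolding cauchy_filter_metric_filtermap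
  proof (intro allI impI)
    fix e :: real assume "e > 0"
    with \<open>(g \<longlongrightarrow> 0) at_top\<close> have "\<forall>\<^sub>F s in at_top. g s < e / 2"
      by (intro order_tendstoD(2)) auto
    then obtain S where "S \<ge> T" "g S < e / 2"
      unfolding eventually_at_top_linorder by (metis max.cobounded1 max.cobounded2)
    then have "dist (f t) (f S) < e / 2" if "t \<ge> S" for t
      using tail[of S t] that by simp
    then have "dist (f s) (f t) < e" if "s \<ge> S" "t \<ge> S" for s t
      using that dist_triangle_half_l by blast
    then show "\<exists>P. eventually P at_top \<and> (\<forall>s t. P s \<and> P t \<longrightarrow> dist (f s) (f t) < e)"
      using eventually_ge_at_top[of S] by blast
  qed
  then obtain l where lim: "(f \<longlongrightarrow> l) at_top"
    using cauchy_filter_convergent by (auto simp: convergent_filter_iff filterlim_def)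
  have "dist (f s) l \<le> g s" if "s \<ge> T" for s
  proof (rule tendsto_upperbound)
    show "((\<lambda>t. dist (f s) (f t)) \<longlongrightarrow> dist (f s) l) at_top" by (intro tendsto_intros lim)
    show "\<forall>\<^sub>F t in at_top. dist (f s) (f t) \<le> g s"
      using eventually_ge_at_top[of s] by eventually_elim (simp add: tail that dist_commute)
  qed simp
  then show thesis using that by blast
qed

lemma exp_decay_derivative_imp_limit:
  fixes f :: "real \<Rightarrow> 'a::banach"
  assumes deriv: "\<forall>\<^sub>F t in at_top. (f has_vector_derivative f' t) (at t)"
    and "exp_decay f'"
  obtains l where "exp_decay (\<lambda>t. f t - l)"
proof -
  obtain C r where "C > 0" "r > 0" and f'_le: "\<forall>\<^sub>F t in at_top. norm (f' t) \<le> C * exp (- r * t)"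
    using \<open>exp_decay f'\<close> by (rule exp_decayE)
  obtain T where "\<And>t. t \<ge> T \<Longrightarrow> (f has_vector_derivative f' t) (at t)"
    and "\<And>t. t \<ge> T \<Longrightarrow> norm (f' t) \<le> C * exp (- r * t)"
    using eventually_conj[OF deriv f'_le] by (auto simp: eventually_at_top_linorder)
  then have "dist (f t) (f s) \<le> C / r * exp (- r * s)" if "T \<le> s" "s \<le> t" for s t
    unfolding dist_norm using \<open>C > 0\<close> \<open>r > 0\<close> that
    by (intro norm_increment_le_exp[where f' = f']) auto
  then obtain l where "\<forall>s\<ge>T. dist (f s) l \<le> C / r * exp (- r * s)"
    by (rule tail_bound_imp_limit_at_top[OF _ tendsto_exp_neg_at_top[OF \<open>r > 0\<close>]])
  then have "exp_decay (\<lambda>t. f t - l)"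
    using \<open>r > 0\<close> unfolding dist_norm eventually_at_top_linorder exp_decay_def by blast
  then show thesis by (rule that)
qed

lemma lower_barrier:
  fixes f :: "real \<Rightarrow> real"
  assumes "c \<le> f a" "a \<le> b"
    and deriv: "\<And>t. t \<ge> a \<Longrightarrow> (f has_real_derivative f' t) (at t)"
    and crossing: "\<And>t. t \<ge> a \<Longrightarrow> f t = c \<Longrightarrow> 0 < f' t"
  shows "c \<le> f b"
proof (rule ccontr)
  assume "\<not> c \<le> f b"
  have cont: "continuous_on {s..b} f" if "s \<ge> a" for s
    using that by (intro continuous_at_imp_continuous_on ballI DERIV_isCont[OF deriv]) auto
  define A where "A = {a..b} \<inter> f -` {c}"
  have "closed A"
    unfolding A_def by (rule continuous_closed_preimage[OF cont]) simp_all
  then have "compact A"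
    using bounded_subset[of "{a..b}" A] by (auto simp: compact_eq_bounded_closed A_def)
  moreover have "\<exists>s\<ge>a. s \<le> b \<and> f s = c"
    using IVT2'[of f b c a] assms(1,2) \<open>\<not> c \<le> f b\<close> cont[of a] by simp
  then have "A \<noteq> {}" by (auto simp: A_def)
  ultimately obtain s where "s \<in> A" and last: "\<And>t. t \<in> A \<Longrightarrow> t \<le> s"
    using compact_attains_sup[of A] by blast
  then have s_crosses: "a \<le> s" "s < b" "f s = c"
    using \<open>\<not> c \<le> f b\<close> by (force simp: A_def less_le)+
  then obtain d where "d > 0" and incr: "\<And>h. 0 < h \<Longrightarrow> h < d \<Longrightarrow> f s < f (s + h)"
    using DERIV_pos_inc_right[OF deriv crossing] by blast
  define t where "t = min (s + d / 2) b"
  have t_above: "s < t" "t \<le> b" "c < f t"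
    using s_crosses \<open>d > 0\<close> incr[of "t - s"] by (auto simp: t_def)
  then obtain t' where "t \<le> t'" "t' \<le> b" "f t' = c"
    using IVT2'[of f b c t] cont[of t] t_above s_crosses \<open>\<not> c \<le> f b\<close> by auto
  then show False using last[of t'] s_crosses t_above by (simp add: A_def)
qed

lemma exp_decay_perturbed_logistic:
  assumes "a > 0" "\<epsilon> > 0"
    and deriv: "\<forall>\<^sub>F t in at_top. (y has_real_derivative a * (\<theta> - y t) * y t + e t) (at t)"
    and lower: "\<forall>\<^sub>F t in at_top. \<epsilon> \<le> y t" and small: "exp_decay e"
  shows "exp_decay (\<lambda>t. y t - \<theta>)"
proof -
  have "exp_decay (\<lambda>t. (y t - \<theta>)\<^sup>2)"
  proof (rule exp_decay_gronwall)
    show "0 < a * \<epsilon>" using assms by simp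
    show "\<forall>\<^sub>F t in at_top. ((\<lambda>t. (y t - \<theta>)\<^sup>2) has_real_derivative
        2 * (y t - \<theta>) * (a * (\<theta> - y t) * y t + e t)) (at t)"
      using deriv by eventually_elim (auto intro!: derivative_eq_intros)
    show "exp_decay (\<lambda>t. (1 / (a * \<epsilon>)) *\<^sub>R (e t)\<^sup>2)"
      using small exp_decay_norm_power2_iff[of e] by (intro exp_decay_scaleR) simp
    from lower show "\<forall>\<^sub>F t in at_top. 2 * (y t - \<theta>) * (a * (\<theta> - y t) * y t + e t)
        \<le> - (a * \<epsilon>) * (y t - \<theta>)\<^sup>2 + (1 / (a * \<epsilon>)) *\<^sub>R (e t)\<^sup>2"
    proof eventually_elim
      case (elim t)
      define z where "z = y t - \<theta>"
      have "0 \<le> (a * \<epsilon> * z - e t)\<^sup>2 / (a * \<epsilon>)" using assms(1,2) by simp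
      also have "\<dots> = a * \<epsilon> * z\<^sup>2 + (e t)\<^sup>2 / (a * \<epsilon>) - 2 * z * e t"
        using assms(1,2) by (simp add: field_simps power2_eq_square)
      finally have young: "2 * z * e t \<le> a * \<epsilon> * z\<^sup>2 + (e t)\<^sup>2 / (a * \<epsilon>)" by simp
      have "2 * z * (a * (\<theta> - y t) * y t + e t) = - 2 * (a * y t * z\<^sup>2) + 2 * z * e t"
        by (simp add: z_def algebra_simps power2_eq_square)
      also have "\<dots> \<le> - 2 * (a * \<epsilon> * z\<^sup>2) + 2 * z * e t"
        using elim \<open>a > 0\<close> by (auto intro!: mult_right_mono mult_left_mono)
      finally show ?case using young by (simp add: z_def)
    qed
  qed auto
  then show ?thesis using exp_decay_norm_power2_iff[of "\<lambda>t. y t - \<theta>"] by simp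
qed

section \<open>The Rayleigh field\<close>

definition powr_field :: "real \<Rightarrow> 'a::real_normed_vector \<Rightarrow> 'a" where
  "powr_field p a = (norm a powr p) *\<^sub>R a"

definition rayleigh_field :: "real \<Rightarrow> real \<Rightarrow> real \<Rightarrow> 'a::real_normed_vector \<Rightarrow> 'a" where
  "rayleigh_field \<sigma> p \<theta> a = \<sigma> *\<^sub>R (\<theta> *\<^sub>R a - powr_field p a)"

lemma powr_field_monotone:
  fixes a b :: "'a::real_inner"
  assumes "p \<ge> 0"
  shows "0 \<le> inner (a - b) (powr_field p a - powr_field p b)"
proof -
  have increasing: "0 \<le> (s - t) * (s powr p * s - t powr p * t)" if "0 \<le> t" "t \<le> s" for s t :: real
    using that assms by (intro mult_nonneg_nonneg) (auto intro!: mult_mono powr_mono2)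
  have "0 \<le> (norm a - norm b) * (norm a powr p * norm a - norm b powr p * norm b)"
    using increasing[of "norm a" "norm b"] increasing[of "norm b" "norm a"]
    by (cases "norm a \<le> norm b") (auto simp: algebra_simps)
  moreover have "0 \<le> (norm a powr p + norm b powr p) * (norm a * norm b - inner a b)"
    by (intro mult_nonneg_nonneg) (auto simp: norm_cauchy_schwarz)
  moreover have "inner (a - b) (powr_field p a - powr_field p b)
      = (norm a - norm b) * (norm a powr p * norm a - norm b powr p * norm b)
        + (norm a powr p + norm b powr p) * (norm a * norm b - inner a b)"
    by (simp add: powr_field_def inner_diff_left inner_diff_right inner_commute
        flip: power2_norm_eq_inner) (simp add: algebra_simps power2_eq_square)
  ultimately show ?thesis by linarith
qed

lemma powr_diff_mult_le:
  fixes p :: real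
  assumes "p > 0" "0 \<le> s" "s \<le> t" "t \<le> B"
  shows "(t powr p - s powr p) * s \<le> p * B powr p * (t - s)"
proof (cases "s = 0 \<or> s = t")
  case False
  then have "0 < s" "s < t" using assms by auto
  obtain z where z: "s < z" "z < t" "t powr p - s powr p = (t - s) * (p * z powr (p - 1))"
    using MVT2[OF \<open>s < t\<close>, of "\<lambda>z. z powr p" "\<lambda>z. p * z powr (p - 1)"]
      has_real_derivative_powr \<open>0 < s\<close>
    by (metis less_le_trans)
  have "(t powr p - s powr p) * s \<le> (t powr p - s powr p) * z"
    using z assms by (intro mult_left_mono) (auto intro: powr_mono2)
  also have "\<dots> = p * z powr p * (t - s)"
    using z \<open>0 < s\<close> by (simp add: powr_diff)
  also have "\<dots> \<le> p * B powr p * (t - s)"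
    using z \<open>0 < s\<close> assms by (intro mult_right_mono mult_left_mono powr_mono2) auto
  finally show ?thesis .
qed (use assms in auto)

lemma lipschitz_on_powr_field:
  assumes "p > 0"
  shows "((p + 1) * B powr p)-lipschitz_on (cball 0 B)
    (powr_field p :: 'a::real_normed_vector \<Rightarrow> 'a)"
proof (rule lipschitz_onI)
  have ordered: "dist (powr_field p a) (powr_field p b) \<le> (p + 1) * B powr p * dist a b"
    if "norm a \<le> norm b" "norm b \<le> B" for a b :: 'a
  proof -
    have "powr_field p a - powr_field p b
        = (norm b powr p) *\<^sub>R (a - b) - (norm b powr p - norm a powr p) *\<^sub>R a"
      by (simp add: powr_field_def algebra_simps)
    then have "dist (powr_field p a) (powr_field p b)
        \<le> norm b powr p * norm (a - b) + \<bar>norm b powr p - norm a powr p\<bar> * norm a"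
      unfolding dist_norm
      using norm_triangle_ineq4[of "(norm b powr p) *\<^sub>R (a - b)"
          "(norm b powr p - norm a powr p) *\<^sub>R a"]
      by simp
    also have "\<bar>norm b powr p - norm a powr p\<bar> = norm b powr p - norm a powr p"
      using that assms by (intro abs_of_nonneg) (auto intro: powr_mono2)
    also have "(norm b powr p - norm a powr p) * norm a \<le> p * B powr p * (norm b - norm a)"
      using powr_diff_mult_le[OF assms _ that] by simp
    also have "\<dots> \<le> p * B powr p * norm (a - b)"
      using assms norm_triangle_ineq3[of a b] by (intro mult_left_mono) auto
    also have "norm b powr p * norm (a - b) \<le> B powr p * norm (a - b)"
      using that assms by (intro mult_right_mono powr_mono2) auto
    finally show ?thesis by (simp add: dist_norm algebra_simps)
  qed
  fix a b :: 'a assume "a \<in> cball 0 B" "b \<in> cball 0 B"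
  then show "dist (powr_field p a) (powr_field p b) \<le> (p + 1) * B powr p * dist a b"
    using ordered[of a b] ordered[of b a] by (cases "norm a \<le> norm b") (auto simp: dist_commute)
qed (use assms in simp)

lemma superquadratic_damping_bound:
  fixes \<theta> p :: real
  assumes "p > 0"
  obtains L where "\<And>s. s \<ge> 0 \<Longrightarrow> (\<theta> - s powr p) * s\<^sup>2 \<le> L - s\<^sup>2"
proof
  define K where "K = \<bar>\<theta>\<bar> + 1"
  have "K > 0" by (simp add: K_def)
  fix s :: real assume "s \<ge> 0"
  have "(\<theta> + 1 - s powr p) * s\<^sup>2 \<le> (K - s powr p) * s\<^sup>2"
    by (intro mult_right_mono) (auto simp: K_def)
  also have "\<dots> \<le> K * (K powr (1/p))\<^sup>2"
  proof (cases "s powr p \<le> K")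
    case True
    then have "(s powr p) powr (1/p) \<le> K powr (1/p)" using \<open>p > 0\<close> by (intro powr_mono2) auto
    then have "s \<le> K powr (1/p)" using \<open>s \<ge> 0\<close> \<open>p > 0\<close> by (simp add: powr_powr split: if_splits)
    then show ?thesis using \<open>s \<ge> 0\<close> True \<open>K > 0\<close> by (intro mult_mono power_mono) auto
  next
    case False
    then have "(K - s powr p) * s\<^sup>2 \<le> 0" by (intro mult_nonpos_nonneg) auto
    also have "0 \<le> K * (K powr (1/p))\<^sup>2" using \<open>K > 0\<close> by simp
    finally show ?thesis .
  qed
  finally show "(\<theta> - s powr p) * s\<^sup>2 \<le> K * (K powr (1/p))\<^sup>2 - s\<^sup>2" by (simp add: algebra_simps)
qed

lemma inner_rayleigh_field_self:
  fixes a :: "'a::real_inner"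
  shows "inner a (rayleigh_field \<sigma> p \<theta> a) = \<sigma> * ((\<theta> - norm a powr p) * (norm a)\<^sup>2)"
  by (simp add: rayleigh_field_def powr_field_def power2_norm_eq_inner algebra_simps)

lemma rayleigh_field_diff:
  "rayleigh_field \<sigma> p \<theta> a - rayleigh_field \<sigma> p \<theta>' b
    = \<sigma> *\<^sub>R (\<theta>' *\<^sub>R (a - b) + (\<theta> - \<theta>') *\<^sub>R a - (powr_field p a - powr_field p b))"
  by (simp add: rayleigh_field_def algebra_simps)

section \<open>Exponentially small perturbations of the Rayleigh equation\<close>

locale perturbed_rayleigh =
  fixes \<sigma> p \<theta> :: real and u R :: "real \<Rightarrow> 'a::{real_inner, banach}"
  assumes \<sigma>_pos: "\<sigma> > 0" and p_pos: "p > 0" and \<theta>_pos: "\<theta> > 0"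
    and deriv: "\<forall>\<^sub>F t in at_top. (u has_vector_derivative rayleigh_field \<sigma> p \<theta> (u t) + R t) (at t)"
    and perturbation: "exp_decay R" and bounded: "Bfun u at_top"
begin

lemma small_radius_below_equilibrium:
  assumes "\<epsilon> > 0"
  obtains \<delta> where "0 < \<delta>" "\<delta> \<le> \<epsilon>" "\<delta> powr p < \<theta>"
proof
  define \<delta> where "\<delta> = min \<epsilon> ((\<theta> / 2) powr (1/p))"
  show "0 < \<delta>" "\<delta> \<le> \<epsilon>" using assms \<theta>_pos by (auto simp: \<delta>_def)
  have "\<delta> powr p \<le> ((\<theta> / 2) powr (1/p)) powr p"
    using \<open>0 < \<delta>\<close> p_pos by (intro powr_mono2) (auto simp: \<delta>_def)
  also have "\<dots> < \<theta>" using p_pos \<theta>_pos by (simp add: powr_powr)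
  finally show "\<delta> powr p < \<theta>" .
qed

lemma norm_stays_above:
  assumes "\<delta> > 0"
    and deriv_from: "\<And>t. t \<ge> T \<Longrightarrow> (u has_vector_derivative rayleigh_field \<sigma> p \<theta> (u t) + R t) (at t)"
    and R_less: "\<And>t. t \<ge> T \<Longrightarrow> norm (R t) < \<sigma> * (\<theta> - \<delta> powr p) * \<delta>"
    and "\<delta> \<le> norm (u T)" "t \<ge> T"
  shows "\<delta> \<le> norm (u t)"
proof -
  have "\<delta>\<^sup>2 \<le> (norm (u t))\<^sup>2"
  proof (rule lower_barrier[OF _ \<open>t \<ge> T\<close>])
    show "\<delta>\<^sup>2 \<le> (norm (u T))\<^sup>2"
      using \<open>\<delta> > 0\<close> \<open>\<delta> \<le> norm (u T)\<close> by (intro power_mono) auto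
    fix s assume "s \<ge> T"
    then show "((\<lambda>t. (norm (u t))\<^sup>2) has_real_derivative
        2 * inner (u s) (rayleigh_field \<sigma> p \<theta> (u s) + R s)) (at s)"
      by (intro has_real_derivative_norm_power2 deriv_from)
    assume "(norm (u s))\<^sup>2 = \<delta>\<^sup>2"
    then have "norm (u s) = \<delta>" using \<open>\<delta> > 0\<close> by simp
    then have "- inner (u s) (R s) \<le> \<delta> * norm (R s)"
      using Cauchy_Schwarz_ineq2[of "u s" "R s"] by simp
    also have "\<dots> < \<delta> * (\<sigma> * (\<theta> - \<delta> powr p) * \<delta>)"
      using \<open>\<delta> > 0\<close> R_less[OF \<open>s \<ge> T\<close>] by (rule mult_strict_left_mono[rotated])
    also have "\<dots> = inner (u s) (rayleigh_field \<sigma> p \<theta> (u s))"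
      using \<open>norm (u s) = \<delta>\<close> by (simp add: inner_rayleigh_field_self power2_eq_square)
    finally show "0 < 2 * inner (u s) (rayleigh_field \<sigma> p \<theta> (u s) + R s)"
      by (simp add: inner_add_right)
  qed
  then show ?thesis by (rule power2_le_imp_le) simp
qed

lemma bounded_below_or_vanishing:
  obtains (vanishing) "(u \<longlongrightarrow> 0) at_top"
  | (bounded_below) \<delta> where "\<delta> > 0" "\<forall>\<^sub>F t in at_top. \<delta> \<le> norm (u t)"
proof (cases "(u \<longlongrightarrow> 0) at_top")
  case False
  then obtain \<epsilon> where "\<epsilon> > 0" and \<epsilon>: "\<not> (\<forall>\<^sub>F t in at_top. norm (u t) < \<epsilon>)"
    by (auto simp: tendsto_iff)
  obtain \<delta> where "0 < \<delta>" "\<delta> \<le> \<epsilon>" "\<delta> powr p < \<theta>"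
    using small_radius_below_equilibrium[OF \<open>\<epsilon> > 0\<close>] .
  then have "0 < \<sigma> * (\<theta> - \<delta> powr p) * \<delta>" using \<sigma>_pos by simp
  then have "\<forall>\<^sub>F t in at_top. norm (R t) < \<sigma> * (\<theta> - \<delta> powr p) * \<delta>"
    using exp_decay_tendsto_0[OF perturbation] unfolding tendsto_iff dist_0_norm by simp
  from eventually_conj[OF deriv this]
  obtain S where deriv_from:
      "\<And>t. t \<ge> S \<Longrightarrow> (u has_vector_derivative rayleigh_field \<sigma> p \<theta> (u t) + R t) (at t)"
    and R_less: "\<And>t. t \<ge> S \<Longrightarrow> norm (R t) < \<sigma> * (\<theta> - \<delta> powr p) * \<delta>"
    by (auto simp: eventually_at_top_linorder)
  obtain T where "T \<ge> S" "\<epsilon> \<le> norm (u T)"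
    using \<epsilon> unfolding eventually_at_top_linorder by (metis not_less)
  have "\<delta> \<le> norm (u t)" if "t \<ge> T" for t
    using \<open>T \<ge> S\<close> \<open>\<delta> \<le> \<epsilon>\<close> \<open>\<epsilon> \<le> norm (u T)\<close> that
    by (intro norm_stays_above[OF \<open>0 < \<delta>\<close>, of T t] deriv_from R_less) auto
  then have "\<forall>\<^sub>F t in at_top. \<delta> \<le> norm (u t)"
    unfolding eventually_at_top_linorder by blast
  with \<open>0 < \<delta>\<close> show thesis by (rule bounded_below)
qed (rule vanishing)

lemma speed_powr_decay:
  assumes "\<delta> > 0" and lower: "\<forall>\<^sub>F t in at_top. \<delta> \<le> norm (u t)"
  shows "exp_decay (\<lambda>t. norm (u t) powr p - \<theta>)"
proof (rule exp_decay_perturbed_logistic)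
  define e where "e t = p * norm (u t) powr (p - 2) * inner (u t) (R t)" for t
  show "0 < p * \<sigma>" "0 < \<delta> powr p" using \<sigma>_pos p_pos \<open>\<delta> > 0\<close> by auto
  show "\<forall>\<^sub>F t in at_top. \<delta> powr p \<le> norm (u t) powr p"
    using lower by eventually_elim (use \<open>\<delta> > 0\<close> p_pos in \<open>auto intro: powr_mono2\<close>)
  show "\<forall>\<^sub>F t in at_top. ((\<lambda>t. norm (u t) powr p) has_real_derivative
      p * \<sigma> * (\<theta> - norm (u t) powr p) * norm (u t) powr p + e t) (at t)"
    using deriv lower
  proof eventually_elim
    case (elim t)
    then have "u t \<noteq> 0" using \<open>\<delta> > 0\<close> by auto
    have "norm (u t) powr (p - 2) * (norm (u t))\<^sup>2 = norm (u t) powr p"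
      using \<open>u t \<noteq> 0\<close> by (simp add: powr_diff)
    then have "p * norm (u t) powr (p - 2) * inner (u t) (rayleigh_field \<sigma> p \<theta> (u t) + R t)
        = p * \<sigma> * (\<theta> - norm (u t) powr p) * norm (u t) powr p + e t"
      by (simp add: e_def inner_add_right inner_rayleigh_field_self distrib_left mult_ac)
    then show ?case using has_real_derivative_norm_powr[OF elim(1) \<open>u t \<noteq> 0\<close>, of p] by simp
  qed
  obtain B where "B > 0" and u_le: "\<forall>\<^sub>F t in at_top. norm (u t) \<le> B"
    using bounded by (rule BfunE)
  from lower u_le have "\<forall>\<^sub>F t in at_top. norm (e t) \<le> p * (B powr p / \<delta>) * norm (R t)"
  proof eventually_elim
    case (elim t)
    then have "norm (u t) > 0" using \<open>\<delta> > 0\<close> by linarith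
    have "norm (e t) \<le> p * norm (u t) powr (p - 2) * (norm (u t) * norm (R t))"
      using p_pos Cauchy_Schwarz_ineq2[of "u t" "R t"]
      by (auto simp: e_def abs_mult intro!: mult_left_mono)
    also have "\<dots> = p * (norm (u t) powr p / norm (u t)) * norm (R t)"
      using \<open>norm (u t) > 0\<close> by (simp add: powr_diff field_simps power2_eq_square)
    also have "\<dots> \<le> p * (B powr p / \<delta>) * norm (R t)"
      using elim p_pos \<open>\<delta> > 0\<close> by (intro mult_right_mono mult_left_mono frac_le powr_mono2) auto
    finally show ?case .
  qed
  with perturbation show "exp_decay e" by (rule exp_decay_dominated)
qed

lemma vanishing_or_limit:
  obtains (vanishing) "(u \<longlongrightarrow> 0) at_top"
  | (limit) l where "norm l = \<theta> powr (1/p)" "exp_decay (\<lambda>t. u t - l)"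
proof (cases rule: bounded_below_or_vanishing)
  case (bounded_below \<delta>)
  then have speed: "exp_decay (\<lambda>t. norm (u t) powr p - \<theta>)" by (rule speed_powr_decay)
  have "rayleigh_field \<sigma> p \<theta> (u t) = (- \<sigma>) *\<^sub>R ((norm (u t) powr p - \<theta>) *\<^sub>R u t)" for t
    by (simp add: rayleigh_field_def powr_field_def algebra_simps)
  then have "exp_decay (\<lambda>t. rayleigh_field \<sigma> p \<theta> (u t) + R t)"
    using bounded_bilinear.exp_decay_prod_left[OF bounded_bilinear_scaleR speed bounded]
    by (simp only: exp_decay_add exp_decay_scaleR perturbation)
  with deriv obtain l where decay: "exp_decay (\<lambda>t. u t - l)"
    by (rule exp_decay_derivative_imp_limit)
  have "(u \<longlongrightarrow> l) at_top" using exp_decay_tendsto_0[OF decay] by (simp add: LIM_zero_iff)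
  then have "((\<lambda>t. norm (u t) powr p) \<longlongrightarrow> norm l powr p) at_top"
    using p_pos by (intro tendsto_powr' tendsto_intros) auto
  moreover have "((\<lambda>t. norm (u t) powr p) \<longlongrightarrow> \<theta>) at_top"
    using exp_decay_tendsto_0[OF speed] by (simp add: LIM_zero_iff)
  ultimately have "norm l powr p = \<theta>" by (rule tendsto_unique[rotated]) simp
  then have "norm l = \<theta> powr (1/p)" using p_pos by (auto simp: powr_powr)
  then show thesis using decay by (rule limit)
qed (rule vanishing)

end

section \<open>Weighted families and alignment\<close>

locale weights =
  fixes I :: "'i set" and m :: "'i \<Rightarrow> real"
  assumes finite_I: "finite I" and I_nonempty: "I \<noteq> {}" and m_pos: "i \<in> I \<Longrightarrow> m i > 0"
begin

definition mass :: real where "mass = (\<Sum>i\<in>I. m i)"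

definition wmean :: "('i \<Rightarrow> 'a::real_vector) \<Rightarrow> 'a" where
  "wmean z = (1 / mass) *\<^sub>R (\<Sum>i\<in>I. m i *\<^sub>R z i)"

definition deviation :: "('i \<Rightarrow> 'a::real_vector) \<Rightarrow> 'i \<Rightarrow> 'a" where
  "deviation z i = z i - wmean z"

definition wdot :: "('i \<Rightarrow> 'a::real_inner) \<Rightarrow> ('i \<Rightarrow> 'a) \<Rightarrow> real" where
  "wdot y z = (\<Sum>i\<in>I. m i * inner (y i) (z i))"

definition wvar :: "('i \<Rightarrow> 'a::real_inner) \<Rightarrow> real" where
  "wvar z = wdot (deviation z) (deviation z)"

definition alignment :: "('i \<Rightarrow> 'i \<Rightarrow> real) \<Rightarrow> ('i \<Rightarrow> 'a::real_vector) \<Rightarrow> 'i \<Rightarrow> 'a" where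
  "alignment w z i = (\<Sum>j\<in>I. (m j * w i j) *\<^sub>R (z j - z i))"

lemma mass_pos: "mass > 0"
  unfolding mass_def using finite_I I_nonempty m_pos by (intro sum_pos)

lemma sum_weighted: "(\<Sum>i\<in>I. m i *\<^sub>R z i) = mass *\<^sub>R wmean z"
  using mass_pos by (simp add: wmean_def)

lemma wmean_const: "wmean (\<lambda>i. c) = c"
  using mass_pos by (simp add: wmean_def mass_def flip: scaleR_sum_left)

lemma wmean_add: "wmean (\<lambda>i. f i + g i) = wmean f + wmean g"
  by (simp add: wmean_def scaleR_add_right sum.distrib)

lemma wmean_diff: "wmean (\<lambda>i. f i - g i) = wmean f - wmean g"
  by (simp add: wmean_def scaleR_diff_right sum_subtractf)

lemma wmean_scaleR: "wmean (\<lambda>i. c *\<^sub>R f i) = c *\<^sub>R wmean f"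
  by (simp add: wmean_def scaleR_sum_right mult_ac)

lemma norm_wmean_le:
  assumes "\<And>i. i \<in> I \<Longrightarrow> norm (z i) \<le> B"
  shows "norm (wmean z) \<le> B"
proof -
  have "norm (\<Sum>i\<in>I. m i *\<^sub>R z i) \<le> (\<Sum>i\<in>I. m i * B)"
    using assms m_pos by (intro sum_norm_le) (auto simp: less_imp_le)
  also have "\<dots> = mass * B" by (simp add: mass_def sum_distrib_right)
  finally show ?thesis using mass_pos by (simp add: wmean_def field_simps)
qed

lemma wmean_has_vector_derivative:
  assumes "\<And>i. i \<in> I \<Longrightarrow> ((\<lambda>t. z t i) has_vector_derivative z' i) F"
  shows "((\<lambda>t. wmean (z t)) has_vector_derivative wmean z') F"
  unfolding wmean_def
  by (intro bounded_linear.has_vector_derivative[OF bounded_linear_scaleR_right]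
      has_vector_derivative_sum assms) auto

lemma deviation_has_vector_derivative:
  assumes "\<And>i. i \<in> I \<Longrightarrow> ((\<lambda>t. z t i) has_vector_derivative z' i) F" "i \<in> I"
  shows "((\<lambda>t. deviation (z t) i) has_vector_derivative deviation z' i) F"
  unfolding deviation_def using assms
  by (intro has_vector_derivative_diff wmean_has_vector_derivative)

lemma exp_decay_wmean:
  fixes z :: "real \<Rightarrow> 'i \<Rightarrow> 'a::real_normed_vector"
  assumes "\<And>i. i \<in> I \<Longrightarrow> exp_decay (\<lambda>t. z t i)"
  shows "exp_decay (\<lambda>t. wmean (z t))"
  unfolding wmean_def using assms by (intro exp_decay_scaleR exp_decay_sum)

lemma wdot_add_right: "wdot y (\<lambda>i. f i + g i) = wdot y f + wdot y g"
  by (simp add: wdot_def inner_add_right distrib_left sum.distrib)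

lemma wdot_diff_right: "wdot y (\<lambda>i. f i - g i) = wdot y f - wdot y g"
  by (simp add: wdot_def inner_diff_right right_diff_distrib sum_subtractf)

lemma wdot_scaleR_right: "wdot y (\<lambda>i. c *\<^sub>R f i) = c * wdot y f"
  by (simp add: wdot_def sum_distrib_left mult_ac)

lemma wdot_deviation_const: "wdot (deviation z) (\<lambda>i. c) = 0"
proof -
  have "wdot (deviation z) (\<lambda>i. c) = inner (\<Sum>i\<in>I. m i *\<^sub>R deviation z i) c"
    by (simp add: wdot_def inner_sum_left)
  also have "(\<Sum>i\<in>I. m i *\<^sub>R deviation z i) = 0"
    by (simp only: sum_weighted deviation_def wmean_diff wmean_const) simp
  finally show ?thesis by simp
qed

lemma wdot_deviation_deviation: "wdot (deviation y) (deviation z) = wdot (deviation y) z"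
  unfolding deviation_def[of z] wdot_diff_right wdot_deviation_const by simp

lemma wdot_self_nonneg: "0 \<le> wdot z z"
  unfolding wdot_def using m_pos by (intro sum_nonneg) (auto simp: less_imp_le)

lemma wvar_nonneg: "0 \<le> wvar z"
  unfolding wvar_def by (rule wdot_self_nonneg)

lemma norm_power2_le_wdot_self:
  assumes "i \<in> I"
  shows "(norm (z i))\<^sup>2 \<le> wdot z z / Min (m ` I)"
proof -
  have "Min (m ` I) > 0" using finite_I I_nonempty m_pos by simp
  have "Min (m ` I) * (norm (z i))\<^sup>2 \<le> m i * (norm (z i))\<^sup>2"
    using finite_I assms by (intro mult_right_mono) auto
  also have "\<dots> \<le> wdot z z"
    unfolding wdot_def power2_norm_eq_inner using finite_I m_pos assms
    by (intro member_le_sum[of i I "\<lambda>i. m i * inner (z i) (z i)"]) (auto simp: less_imp_le)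
  finally show ?thesis using \<open>Min (m ` I) > 0\<close> by (simp add: field_simps)
qed

lemma wdot_self_has_real_derivative:
  assumes "\<And>i. i \<in> I \<Longrightarrow> ((\<lambda>t. z t i) has_vector_derivative z' i) (at t within S)"
  shows "((\<lambda>t. wdot (z t) (z t)) has_real_derivative 2 * wdot (z t) z') (at t within S)"
proof -
  have "((\<lambda>t. wdot (z t) (z t)) has_real_derivative (\<Sum>i\<in>I. m i * (2 * inner (z t i) (z' i))))
      (at t within S)"
    unfolding wdot_def power2_norm_eq_inner[symmetric]
    by (intro DERIV_sum DERIV_cmult has_real_derivative_norm_power2 assms) auto
  then show ?thesis by (simp add: wdot_def sum_distrib_left mult_ac)
qed

lemma wvar_has_real_derivative:
  assumes "\<And>i. i \<in> I \<Longrightarrow> ((\<lambda>t. z t i) has_vector_derivative z' i) (at t within S)"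
  shows "((\<lambda>t. wvar (z t)) has_real_derivative 2 * wdot (deviation (z t)) z') (at t within S)"
  using wdot_self_has_real_derivative[of "\<lambda>t. deviation (z t)",
      OF deviation_has_vector_derivative[of z, OF assms]]
  unfolding wvar_def wdot_deviation_deviation[of _ z'] .

lemma exp_decay_wdot:
  fixes y z :: "real \<Rightarrow> 'i \<Rightarrow> 'a::real_inner"
  assumes "\<And>i. i \<in> I \<Longrightarrow> Bfun (\<lambda>t. y t i) at_top" "\<And>i. i \<in> I \<Longrightarrow> exp_decay (\<lambda>t. z t i)"
  shows "exp_decay (\<lambda>t. wdot (y t) (z t))"
  unfolding wdot_def real_scaleR_def[symmetric] using assms
  by (intro exp_decay_sum exp_decay_scaleR
      bounded_bilinear.exp_decay_prod_right[OF bounded_bilinear_inner])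

lemma exp_decay_wdot_self_imp:
  fixes z :: "real \<Rightarrow> 'i \<Rightarrow> 'a::real_inner"
  assumes "exp_decay (\<lambda>t. wdot (z t) (z t))" "i \<in> I"
  shows "exp_decay (\<lambda>t. z t i)"
proof -
  have "norm ((norm (z t i))\<^sup>2) \<le> 1 / Min (m ` I) * norm (wdot (z t) (z t))" for t
    using norm_power2_le_wdot_self[OF assms(2), of "z t"] wdot_self_nonneg[of "z t"] by simp
  then have "exp_decay (\<lambda>t. (norm (z t i))\<^sup>2)"
    by (intro exp_decay_dominated[OF assms(1)] always_eventually allI)
  then show ?thesis by (simp only: exp_decay_norm_power2_iff)
qed

lemma wdot_deviation_monotone_nonneg:
  assumes "\<And>a b. 0 \<le> inner (a - b) (F a - F b)"
  shows "0 \<le> wdot (deviation z) (\<lambda>i. F (z i))"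
proof -
  have "0 \<le> wdot (deviation z) (\<lambda>i. F (z i) - F (wmean z))"
    unfolding wdot_def deviation_def using assms m_pos
    by (intro sum_nonneg mult_nonneg_nonneg) (auto simp: less_imp_le)
  then show ?thesis by (simp add: wdot_diff_right wdot_deviation_const)
qed

lemma norm_deviation_le:
  assumes "\<And>i. i \<in> I \<Longrightarrow> norm (z i) \<le> B" "i \<in> I"
  shows "norm (deviation z i) \<le> 2 * B"
  using norm_triangle_ineq4[of "z i" "wmean z"] norm_wmean_le[of z B] assms(1)[OF assms(2)] assms(1)
  unfolding deviation_def by fastforce

lemma wdot_rayleigh_field_le:
  assumes "p > 0" "\<sigma> \<ge> 0"
  obtains K where "\<And>(z :: 'i \<Rightarrow> 'a::real_inner) \<theta>. (\<And>i. i \<in> I \<Longrightarrow> \<theta> i \<le> \<Theta>) \<Longrightarrow>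
    wdot z (\<lambda>i. rayleigh_field \<sigma> p (\<theta> i) (z i)) \<le> K - \<sigma> * wdot z z"
proof -
  obtain L where damping: "\<And>s. s \<ge> 0 \<Longrightarrow> (\<Theta> - s powr p) * s\<^sup>2 \<le> L - s\<^sup>2"
    using superquadratic_damping_bound[OF \<open>p > 0\<close>] by blast
  have "wdot z (\<lambda>i. rayleigh_field \<sigma> p (\<theta> i) (z i)) \<le> \<sigma> * L * mass - \<sigma> * wdot z z"
    if \<theta>_le: "\<And>i. i \<in> I \<Longrightarrow> \<theta> i \<le> \<Theta>" for z :: "'i \<Rightarrow> 'a" and \<theta>
  proof -
    have "wdot z (\<lambda>i. rayleigh_field \<sigma> p (\<theta> i) (z i)) \<le> (\<Sum>i\<in>I. m i * (\<sigma> * (L - (norm (z i))\<^sup>2)))"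
      unfolding wdot_def inner_rayleigh_field_self
    proof (intro sum_mono mult_left_mono)
      fix i assume "i \<in> I"
      have "(\<theta> i - norm (z i) powr p) * (norm (z i))\<^sup>2 \<le> (\<Theta> - norm (z i) powr p) * (norm (z i))\<^sup>2"
        using \<theta>_le[OF \<open>i \<in> I\<close>] by (intro mult_right_mono) auto
      also have "\<dots> \<le> L - (norm (z i))\<^sup>2" by (rule damping) simp
      finally show "(\<theta> i - norm (z i) powr p) * (norm (z i))\<^sup>2 \<le> L - (norm (z i))\<^sup>2" .
    qed (use \<open>\<sigma> \<ge> 0\<close> m_pos in \<open>auto simp: less_imp_le\<close>)
    also have "\<dots> = \<sigma> * L * mass - \<sigma> * wdot z z"
      unfolding wdot_def mass_def power2_norm_eq_inner sum_distrib_left sum_subtractf[symmetric]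
      by (intro sum.cong) (auto simp: algebra_simps)
    finally show ?thesis .
  qed
  then show thesis by (rule that)
qed

lemma alignment_deviation: "alignment w (deviation z) = alignment w z"
  by (simp add: fun_eq_iff alignment_def deviation_def)

lemma alignment_one: "alignment (\<lambda>i j. 1) z = (\<lambda>i. (- mass) *\<^sub>R deviation z i)"
  by (simp add: fun_eq_iff alignment_def deviation_def scaleR_diff_right sum_subtractf
      sum_weighted mass_def flip: scaleR_sum_left)

context
  fixes w :: "'i \<Rightarrow> 'i \<Rightarrow> real"
  assumes w_sym: "\<And>i j. w i j = w j i"
begin

lemma wmean_alignment: "wmean (alignment w z) = 0"
proof -
  let ?S = "\<Sum>i\<in>I. \<Sum>j\<in>I. (m i * m j * w i j) *\<^sub>R (z j - z i)"
  have "?S = (\<Sum>j\<in>I. \<Sum>i\<in>I. (m i * m j * w i j) *\<^sub>R (z j - z i))" by (rule sum.swap)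
  also have "\<dots> = (\<Sum>i\<in>I. \<Sum>j\<in>I. - ((m i * m j * w i j) *\<^sub>R (z j - z i)))"
    by (intro sum.cong refl) (subst w_sym, simp add: algebra_simps)
  also have "\<dots> = - ?S" by (simp add: sum_negf)
  finally have "?S = 0" by (simp add: eq_neg_iff_add_eq_0 flip: scaleR_2)
  then show ?thesis by (simp add: wmean_def alignment_def scaleR_sum_right mult_ac)
qed

lemma wdot_alignment:
  "wdot z (alignment w z) = - (1/2) * (\<Sum>i\<in>I. \<Sum>j\<in>I. m i * m j * w i j * (norm (z i - z j))\<^sup>2)"
proof -
  have double_sum: "wdot z (alignment w z)
      = (\<Sum>i\<in>I. \<Sum>j\<in>I. m i * m j * w i j * inner (z i) (z j - z i))"
    by (simp add: wdot_def alignment_def inner_sum_right sum_distrib_left mult_ac)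
  also have "\<dots> = (\<Sum>j\<in>I. \<Sum>i\<in>I. m i * m j * w i j * inner (z i) (z j - z i))"
    by (rule sum.swap)
  also have "\<dots> = (\<Sum>i\<in>I. \<Sum>j\<in>I. m i * m j * w i j * inner (z j) (z i - z j))"
    by (intro sum.cong refl) (subst w_sym, simp add: mult_ac)
  finally have "2 * wdot z (alignment w z)
      = (\<Sum>i\<in>I. \<Sum>j\<in>I. m i * m j * w i j * inner (z i) (z j - z i)
        + m i * m j * w i j * inner (z j) (z i - z j))"
    using double_sum by (simp add: sum.distrib)
  also have "\<dots> = (\<Sum>i\<in>I. \<Sum>j\<in>I. - (m i * m j * w i j * (norm (z i - z j))\<^sup>2))"
    by (intro sum.cong refl)
       (simp add: power2_norm_eq_inner inner_commute algebra_simps)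
  finally show ?thesis by (simp add: sum_negf)
qed

lemma wdot_alignment_nonpos:
  assumes "\<And>i j. i \<in> I \<Longrightarrow> j \<in> I \<Longrightarrow> 0 \<le> w i j"
  shows "wdot z (alignment w z) \<le> 0"
  unfolding wdot_alignment using assms m_pos
  by (auto intro!: sum_nonneg mult_nonneg_nonneg simp: less_imp_le)

lemma wdot_deviation_alignment:
  "wdot (deviation z) (alignment w z)
    = - (1/2) * (\<Sum>i\<in>I. \<Sum>j\<in>I. m i * m j * w i j * (norm (z i - z j))\<^sup>2)"
  using wdot_alignment[of "deviation z"] unfolding alignment_deviation by (simp add: deviation_def)

end

lemma sum_power2_norm_differences:
  "(\<Sum>i\<in>I. \<Sum>j\<in>I. m i * m j * (norm (z i - z j))\<^sup>2) = 2 * mass * wvar z"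
proof -
  have "wdot (deviation z) (alignment (\<lambda>i j. 1) z) = - mass * wvar z"
    unfolding alignment_one wdot_scaleR_right wvar_def ..
  then show ?thesis by (simp add: wdot_deviation_alignment)
qed

lemma wdot_deviation_alignment_le:
  assumes "\<And>i j. w i j = w j i" and "\<And>i j. i \<in> I \<Longrightarrow> j \<in> I \<Longrightarrow> c \<le> w i j"
  shows "wdot (deviation z) (alignment w z) \<le> - (c * mass * wvar z)"
proof -
  have "c * (2 * mass * wvar z) = (\<Sum>i\<in>I. \<Sum>j\<in>I. m i * m j * c * (norm (z i - z j))\<^sup>2)"
    unfolding sum_power2_norm_differences[symmetric] by (simp add: sum_distrib_left mult_ac)
  also have "\<dots> \<le> (\<Sum>i\<in>I. \<Sum>j\<in>I. m i * m j * w i j * (norm (z i - z j))\<^sup>2)"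
    using assms(2) m_pos by (intro sum_mono mult_right_mono mult_left_mono) (auto simp: less_imp_le)
  finally show ?thesis by (simp add: wdot_deviation_alignment assms(1))
qed

lemma deviation_decay:
  fixes z g :: "real \<Rightarrow> 'i \<Rightarrow> 'a::real_inner"
  assumes deriv: "\<forall>\<^sub>F t in at_top. \<forall>i\<in>I.
      ((\<lambda>t. z t i) has_vector_derivative \<kappa> *\<^sub>R alignment (w t) (z t) i + g t i) (at t)"
    and w_sym: "\<And>t i j. w t i j = w t j i" and w_ge: "\<And>t i j. i \<in> I \<Longrightarrow> j \<in> I \<Longrightarrow> c \<le> w t i j"
    and forcing: "\<forall>\<^sub>F t in at_top. wdot (deviation (z t)) (g t) \<le> \<rho> * wvar (z t) + h t"
    and "exp_decay h" and "\<kappa> \<ge> 0" "\<rho> < \<kappa> * c * mass" and "i \<in> I"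
  shows "exp_decay (\<lambda>t. deviation (z t) i)"
proof -
  have "exp_decay (\<lambda>t. wvar (z t))"
  proof (rule exp_decay_gronwall)
    show "0 < 2 * (\<kappa> * c * mass - \<rho>)" using assms by simp
    show "exp_decay (\<lambda>t. 2 *\<^sub>R h t)" using \<open>exp_decay h\<close> by (rule exp_decay_scaleR)
    show "\<forall>\<^sub>F t in at_top. 0 \<le> wvar (z t)" by (simp add: wvar_nonneg)
    show "\<forall>\<^sub>F t in at_top. ((\<lambda>t. wvar (z t)) has_real_derivative
        2 * wdot (deviation (z t)) (\<lambda>i. \<kappa> *\<^sub>R alignment (w t) (z t) i + g t i)) (at t)"
      using deriv by eventually_elim (auto intro: wvar_has_real_derivative)
    show "\<forall>\<^sub>F t in at_top. 2 * wdot (deviation (z t)) (\<lambda>i. \<kappa> *\<^sub>R alignment (w t) (z t) i + g t i)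
        \<le> - (2 * (\<kappa> * c * mass - \<rho>)) * wvar (z t) + 2 *\<^sub>R h t"
      using forcing
    proof eventually_elim
      case (elim t)
      have "\<kappa> * wdot (deviation (z t)) (alignment (w t) (z t)) \<le> \<kappa> * - (c * mass * wvar (z t))"
        using \<open>\<kappa> \<ge> 0\<close> w_sym w_ge by (intro mult_left_mono wdot_deviation_alignment_le)
      with elim show ?case
        by (simp add: wdot_add_right wdot_scaleR_right algebra_simps)
    qed
  qed
  then show ?thesis
    using exp_decay_wdot_self_imp[of "\<lambda>t. deviation (z t)", OF _ \<open>i \<in> I\<close>] by (simp add: wvar_def)
qed

end

section \<open>The flocking system\<close>

locale csf = weights "{..<N}" m for N :: nat and m +
  fixes \<sigma> p \<kappa> \<phi>\<^sub>0 :: real and \<phi> :: "real \<Rightarrow> real"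
    and x v :: "nat \<Rightarrow> real \<Rightarrow> real ^ 'n" and \<theta> :: "nat \<Rightarrow> real \<Rightarrow> real"
  assumes \<sigma>_pos: "\<sigma> > 0" and p_pos: "p > 0" and \<kappa>_pos: "\<kappa> > 0"
    and \<phi>\<^sub>0_pos: "\<phi>\<^sub>0 > 0" and \<phi>_ge: "\<And>r. r \<ge> 0 \<Longrightarrow> \<phi>\<^sub>0 \<le> \<phi> r"
    and \<theta>_init_pos: "\<And>i. i < N \<Longrightarrow> \<theta> i 0 > 0"
    and strong_coupling: "\<sigma> * wmean (\<lambda>i. \<theta> i 0) < \<phi>\<^sub>0 * mass"
    and solution: "CSF_solution N m \<sigma> p \<kappa> \<phi> x v \<theta>"
begin

definition \<theta>mean :: real where "\<theta>mean = wmean (\<lambda>i. \<theta> i 0)"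

abbreviation V :: "real \<Rightarrow> nat \<Rightarrow> real ^ 'n" where "V t \<equiv> \<lambda>i. v i t"

abbreviation \<Theta> :: "real \<Rightarrow> nat \<Rightarrow> real" where "\<Theta> t \<equiv> \<lambda>i. \<theta> i t"

definition comm_weight :: "real \<Rightarrow> nat \<Rightarrow> nat \<Rightarrow> real" where
  "comm_weight t i j = \<phi> (norm (x i t - x j t))"

definition force :: "real \<Rightarrow> nat \<Rightarrow> real ^ 'n" where
  "force t i = rayleigh_field \<sigma> p (\<theta> i t) (v i t)"

lemma comm_weight_sym: "comm_weight t i j = comm_weight t j i"
  by (simp add: comm_weight_def norm_minus_commute)

lemma comm_weight_ge: "\<phi>\<^sub>0 \<le> comm_weight t i j"
  by (simp add: comm_weight_def \<phi>_ge)

lemma \<theta>mean_pos: "\<theta>mean > 0"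
  unfolding \<theta>mean_def wmean_def using mass_pos I_nonempty m_pos \<theta>_init_pos
  by (auto intro!: divide_pos_pos sum_pos)

lemma velocity_equation:
  assumes "i < N" "t \<ge> 0"
  shows "(v i has_vector_derivative alignment (comm_weight t) (V t) i + force t i)
    (at t within {0..})"
  using solution assms
  unfolding CSF_solution_def alignment_def comm_weight_def force_def rayleigh_field_def
    powr_field_def
  by (simp add: algebra_simps)

lemma \<theta>_equation:
  assumes "i < N" "t \<ge> 0"
  shows "(\<theta> i has_vector_derivative \<kappa> *\<^sub>R alignment (comm_weight t) (\<Theta> t) i) (at t within {0..})"
  using solution assms
  unfolding CSF_solution_def alignment_def comm_weight_def
    has_real_derivative_iff_has_vector_derivative
  by simp

lemma eventually_velocity_equation:
  "\<forall>\<^sub>F t in at_top. \<forall>i\<in>{..<N}.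
    (v i has_vector_derivative alignment (comm_weight t) (V t) i + force t i) (at t)"
  using eventually_has_vector_derivative_at[OF velocity_equation]
  by (intro eventually_ball_finite) auto

lemma eventually_\<theta>_equation:
  "\<forall>\<^sub>F t in at_top. \<forall>i\<in>{..<N}.
    (\<theta> i has_vector_derivative \<kappa> *\<^sub>R alignment (comm_weight t) (\<Theta> t) i) (at t)"
  using eventually_has_vector_derivative_at[OF \<theta>_equation]
  by (intro eventually_ball_finite) auto

lemma wmean_\<theta>_conserved:
  assumes "t \<ge> 0"
  shows "wmean (\<Theta> t) = \<theta>mean"
proof -
  have "((\<lambda>t. wmean (\<Theta> t)) has_vector_derivative 0) (at t within {0..})" if "t \<ge> 0" for t
    using wmean_has_vector_derivative[of \<Theta>, OF \<theta>_equation[OF _ that]]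
    by (simp add: wmean_scaleR wmean_alignment comm_weight_sym del: real_scaleR_def)
  then obtain k where "\<And>t. t \<in> {0..} \<Longrightarrow> wmean (\<Theta> t) = k"
    using has_vector_derivative_zero_constant[of "{0::real..}" "\<lambda>t. wmean (\<Theta> t)"] by auto
  then show ?thesis using assms unfolding \<theta>mean_def by auto
qed

lemma \<theta>_minus_mean_decay:
  assumes "i < N"
  shows "exp_decay (\<lambda>t. \<theta> i t - \<theta>mean)"
proof -
  have "exp_decay (\<lambda>t. deviation (\<Theta> t) i)"
  proof (rule deviation_decay)
    show "\<forall>\<^sub>F t in at_top. \<forall>i\<in>{..<N}. ((\<lambda>t. \<theta> i t) has_vector_derivative
        \<kappa> *\<^sub>R alignment (comm_weight t) (\<Theta> t) i + 0) (at t)"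
      using eventually_\<theta>_equation by simp
    show "\<forall>\<^sub>F t in at_top. wdot (deviation (\<Theta> t)) (\<lambda>i. 0) \<le> 0 * wvar (\<Theta> t) + 0"
      by (simp add: wdot_deviation_const)
  qed (use assms \<kappa>_pos \<phi>\<^sub>0_pos mass_pos in
      \<open>auto intro: exp_decay_zero comm_weight_sym comm_weight_ge\<close>)
  moreover have "\<forall>\<^sub>F t in at_top. norm (\<theta> i t - \<theta>mean) \<le> 1 * norm (deviation (\<Theta> t) i)"
    using eventually_ge_at_top[of 0] by eventually_elim (simp add: deviation_def wmean_\<theta>_conserved)
  ultimately show ?thesis by (rule exp_decay_dominated)
qed

lemma eventually_\<theta>_le_mean_plus_1: "\<forall>\<^sub>F t in at_top. \<forall>i\<in>{..<N}. \<theta> i t \<le> \<theta>mean + 1"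
proof (intro eventually_ball_finite ballI)
  fix i assume "i \<in> {..<N}"
  then have "((\<lambda>t. \<theta> i t - \<theta>mean) \<longlongrightarrow> 0) at_top"
    by (intro exp_decay_tendsto_0 \<theta>_minus_mean_decay) simp
  then have "\<forall>\<^sub>F t in at_top. \<theta> i t - \<theta>mean < 1" by (rule order_tendstoD(2)) simp
  then show "\<forall>\<^sub>F t in at_top. \<theta> i t \<le> \<theta>mean + 1" by eventually_elim simp
qed simp

lemma Bfun_kinetic_energy: "Bfun (\<lambda>t. wdot (V t) (V t)) at_top"
proof -
  obtain K where dissipation: "\<And>(z :: nat \<Rightarrow> real ^ 'n) \<theta>. (\<And>i. i \<in> {..<N} \<Longrightarrow> \<theta> i \<le> \<theta>mean + 1) \<Longrightarrow>
      wdot z (\<lambda>i. rayleigh_field \<sigma> p (\<theta> i) (z i)) \<le> K - \<sigma> * wdot z z"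
    using wdot_rayleigh_field_le[OF p_pos less_imp_le[OF \<sigma>_pos]] by blast
  show ?thesis
  proof (rule Bfun_gronwall)
    show "0 < 2 * \<sigma>" using \<sigma>_pos by simp
    show "\<forall>\<^sub>F t in at_top. 0 \<le> wdot (V t) (V t)" by (simp add: wdot_self_nonneg)
    show "\<forall>\<^sub>F t in at_top. ((\<lambda>t. wdot (V t) (V t)) has_real_derivative
        2 * wdot (V t) (\<lambda>i. alignment (comm_weight t) (V t) i + force t i)) (at t)"
      using eventually_velocity_equation
      by eventually_elim (auto intro: wdot_self_has_real_derivative[of V])
    show "\<forall>\<^sub>F t in at_top. 2 * wdot (V t) (\<lambda>i. alignment (comm_weight t) (V t) i + force t i)
        \<le> - (2 * \<sigma>) * wdot (V t) (V t) + 2 * K"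
      using eventually_\<theta>_le_mean_plus_1
    proof eventually_elim
      case (elim t)
      have "wdot (V t) (alignment (comm_weight t) (V t)) \<le> 0"
        using \<phi>\<^sub>0_pos comm_weight_ge comm_weight_sym
        by (intro wdot_alignment_nonpos) (auto intro: order_trans[OF less_imp_le])
      moreover have "wdot (V t) (\<lambda>i. force t i) \<le> K - \<sigma> * wdot (V t) (V t)"
        unfolding force_def using elim by (intro dissipation) auto
      ultimately show ?case by (simp add: wdot_add_right)
    qed
  qed
qed

lemma velocities_bounded:
  obtains B where "\<forall>\<^sub>F t in at_top. \<forall>i\<in>{..<N}. norm (v i t) \<le> B"
proof -
  obtain E where energy_le: "\<forall>\<^sub>F t in at_top. norm (wdot (V t) (V t)) \<le> E"
    using Bfun_kinetic_energy by (rule BfunE)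
  have "Min (m ` {..<N}) > 0" using I_nonempty m_pos by simp
  have "\<forall>\<^sub>F t in at_top. \<forall>i\<in>{..<N}. norm (v i t) \<le> sqrt (E / Min (m ` {..<N}))"
    using energy_le
  proof eventually_elim
    case (elim t)
    then have "wdot (V t) (V t) / Min (m ` {..<N}) \<le> E / Min (m ` {..<N})"
      using \<open>Min (m ` {..<N}) > 0\<close> by (intro divide_right_mono) auto
    then show ?case
      using norm_power2_le_wdot_self[of _ "V t"] by (blast intro: real_le_rsqrt order_trans)
  qed
  then show thesis by (rule that)
qed

lemma Bfun_velocity:
  assumes "i < N"
  shows "Bfun (v i) at_top"
proof -
  obtain B where "\<forall>\<^sub>F t in at_top. \<forall>i\<in>{..<N}. norm (v i t) \<le> B"
    using velocities_bounded .
  then have "\<forall>\<^sub>F t in at_top. norm (v i t) \<le> B" by eventually_elim (simp add: assms)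
  then show ?thesis by (rule BfunI)
qed

lemma Bfun_velocity_deviation:
  assumes "i < N"
  shows "Bfun (\<lambda>t. deviation (V t) i) at_top"
proof -
  obtain B where "\<forall>\<^sub>F t in at_top. \<forall>i\<in>{..<N}. norm (v i t) \<le> B"
    using velocities_bounded .
  then have "\<forall>\<^sub>F t in at_top. norm (deviation (V t) i) \<le> 2 * B"
    by eventually_elim (use assms in \<open>auto intro: norm_deviation_le\<close>)
  then show ?thesis by (rule BfunI)
qed

lemma exp_decay_\<theta>_fluctuation_velocity:
  assumes "i < N"
  shows "exp_decay (\<lambda>t. (\<theta> i t - \<theta>mean) *\<^sub>R v i t)"
  using \<theta>_minus_mean_decay Bfun_velocity assms
  by (intro bounded_bilinear.exp_decay_prod_left[OF bounded_bilinear_scaleR])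

lemma velocity_deviation_decay:
  assumes "i < N"
  shows "exp_decay (\<lambda>t. deviation (V t) i)"
proof (rule deviation_decay)
  let ?h = "\<lambda>t. wdot (deviation (V t)) (\<lambda>i. (\<theta> i t - \<theta>mean) *\<^sub>R v i t)"
  show "exp_decay (\<lambda>t. \<sigma> *\<^sub>R ?h t)"
    by (intro exp_decay_scaleR exp_decay_wdot exp_decay_\<theta>_fluctuation_velocity
        Bfun_velocity_deviation) auto
  show "\<forall>\<^sub>F t in at_top. wdot (deviation (V t)) (force t) \<le> \<sigma> * \<theta>mean * wvar (V t) + \<sigma> *\<^sub>R ?h t"
  proof (intro always_eventually allI)
    fix t
    have "force t = (\<lambda>i. \<sigma> *\<^sub>R (\<theta>mean *\<^sub>R v i t + (\<theta> i t - \<theta>mean) *\<^sub>R v i t - powr_field p (v i t)))"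
      by (simp add: fun_eq_iff force_def rayleigh_field_def algebra_simps)
    then have "wdot (deviation (V t)) (force t) = \<sigma> * (\<theta>mean * wvar (V t) + ?h t
        - wdot (deviation (V t)) (\<lambda>i. powr_field p (v i t)))"
      by (simp add: wdot_add_right wdot_diff_right wdot_scaleR_right wvar_def
          wdot_deviation_deviation)
    moreover have "0 \<le> wdot (deviation (V t)) (\<lambda>i. powr_field p (v i t))"
      using p_pos by (intro wdot_deviation_monotone_nonneg powr_field_monotone) simp
    ultimately have "wdot (deviation (V t)) (force t) \<le> \<sigma> * (\<theta>mean * wvar (V t) + ?h t)"
      using \<sigma>_pos by simp
    then show "wdot (deviation (V t)) (force t) \<le> \<sigma> * \<theta>mean * wvar (V t) + \<sigma> *\<^sub>R ?h t"
      by (simp only: distrib_left mult.assoc real_scaleR_def)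
  qed
  show "\<forall>\<^sub>F t in at_top. \<forall>i\<in>{..<N}. ((\<lambda>t. V t i) has_vector_derivative
      1 *\<^sub>R alignment (comm_weight t) (V t) i + force t i) (at t)"
    using eventually_velocity_equation by simp
  show "\<sigma> * \<theta>mean < 1 * \<phi>\<^sub>0 * mass" using strong_coupling by (simp add: \<theta>mean_def)
qed (use assms in \<open>auto intro: comm_weight_sym comm_weight_ge\<close>)

lemma eventually_mean_velocity_le:
  assumes "\<forall>\<^sub>F t in at_top. \<forall>i\<in>{..<N}. norm (v i t) \<le> B"
  shows "\<forall>\<^sub>F t in at_top. norm (wmean (V t)) \<le> B"
  using assms by eventually_elim (auto intro: norm_wmean_le)

lemma force_approaches_mean_field:
  assumes "i < N"
  shows "exp_decay (\<lambda>t. force t i - rayleigh_field \<sigma> p \<theta>mean (wmean (V t)))"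
proof -
  obtain B where v_le: "\<forall>\<^sub>F t in at_top. \<forall>i\<in>{..<N}. norm (v i t) \<le> B"
    using velocities_bounded .
  have velocity: "exp_decay (\<lambda>t. v i t - wmean (V t))"
    using velocity_deviation_decay[OF assms] unfolding deviation_def .
  from v_le eventually_mean_velocity_le[OF v_le]
  have "\<forall>\<^sub>F t in at_top. norm (powr_field p (v i t) - powr_field p (wmean (V t)))
      \<le> (p + 1) * B powr p * norm (v i t - wmean (V t))"
    by eventually_elim
      (use assms p_pos in \<open>auto intro!: lipschitz_on_normD[OF lipschitz_on_powr_field]\<close>)
  with velocity have friction: "exp_decay (\<lambda>t. powr_field p (v i t) - powr_field p (wmean (V t)))"
    by (rule exp_decay_dominated)
  show ?thesis
    unfolding force_def rayleigh_field_diff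
    by (rule exp_decay_scaleR[OF exp_decay_diff[OF exp_decay_add[OF
          exp_decay_scaleR[OF velocity] exp_decay_\<theta>_fluctuation_velocity[OF assms]] friction]])
qed

lemma mean_velocity_perturbed_rayleigh:
  "perturbed_rayleigh \<sigma> p \<theta>mean (\<lambda>t. wmean (V t))
    (\<lambda>t. wmean (force t) - rayleigh_field \<sigma> p \<theta>mean (wmean (V t)))"
proof
  obtain B where "\<forall>\<^sub>F t in at_top. \<forall>i\<in>{..<N}. norm (v i t) \<le> B"
    using velocities_bounded .
  then show "Bfun (\<lambda>t. wmean (V t)) at_top" by (rule BfunI[OF eventually_mean_velocity_le])
  show "\<forall>\<^sub>F t in at_top. ((\<lambda>t. wmean (V t)) has_vector_derivative
      rayleigh_field \<sigma> p \<theta>mean (wmean (V t))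
      + (wmean (force t) - rayleigh_field \<sigma> p \<theta>mean (wmean (V t)))) (at t)"
    using eventually_velocity_equation
  proof eventually_elim
    case (elim t)
    have "((\<lambda>t. wmean (V t)) has_vector_derivative
        wmean (\<lambda>i. alignment (comm_weight t) (V t) i + force t i)) (at t)"
      using elim by (intro wmean_has_vector_derivative) auto
    then show ?case by (simp add: wmean_add wmean_alignment comm_weight_sym)
  qed
  have "exp_decay (\<lambda>t. wmean (\<lambda>i. force t i - rayleigh_field \<sigma> p \<theta>mean (wmean (V t))))"
    by (intro exp_decay_wmean force_approaches_mean_field) simp
  then show "exp_decay (\<lambda>t. wmean (force t) - rayleigh_field \<sigma> p \<theta>mean (wmean (V t)))"
    by (simp add: wmean_diff wmean_const)
qed (use \<sigma>_pos p_pos \<theta>mean_pos in auto)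

lemma velocities_vanish_or_converge:
  obtains (vanishing) "\<forall>i<N. (v i \<longlongrightarrow> 0) at_top"
  | (limit) l where "norm l = \<theta>mean powr (1/p)" "\<And>i. i < N \<Longrightarrow> exp_decay (\<lambda>t. v i t - l)"
proof -
  interpret mean_velocity: perturbed_rayleigh \<sigma> p \<theta>mean "\<lambda>t. wmean (V t)"
    "\<lambda>t. wmean (force t) - rayleigh_field \<sigma> p \<theta>mean (wmean (V t))"
    by (rule mean_velocity_perturbed_rayleigh)
  show thesis
  proof (cases rule: mean_velocity.vanishing_or_limit)
    case vanishing
    have "(v i \<longlongrightarrow> 0) at_top" if "i < N" for i
      using tendsto_add[OF exp_decay_tendsto_0[OF velocity_deviation_decay[OF that]] vanishing]
      by (simp add: deviation_def)
    then show thesis using that(1) by blast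
  next
    case (limit l)
    have "exp_decay (\<lambda>t. v i t - l)" if "i < N" for i
      using exp_decay_add[OF velocity_deviation_decay[OF that] limit(2)]
      by (simp add: deviation_def)
    with limit(1) show thesis by (rule that(2))
  qed
qed

lemma velocity_alternative:
  "(\<forall>i<N. (v i \<longlongrightarrow> 0) at_top) \<noteq>
    (\<exists>l. norm l = \<theta>mean powr (1/p) \<and> (\<forall>i<N. exp_decay (\<lambda>t. v i t - l)))"
proof -
  have "\<not> exp_decay (\<lambda>t. v 0 t - l)"
    if "\<forall>i<N. (v i \<longlongrightarrow> 0) at_top" "norm l = \<theta>mean powr (1/p)" for l
  proof
    assume "exp_decay (\<lambda>t. v 0 t - l)"
    then have "(v 0 \<longlongrightarrow> l) at_top" using exp_decay_tendsto_0 LIM_zero_iff by blast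
    moreover have "(v 0 \<longlongrightarrow> 0) at_top" using that I_nonempty by (auto simp: lessThan_empty_iff)
    ultimately have "l = 0" by (intro tendsto_unique[of at_top "v 0"]) auto
    then show False using that \<theta>mean_pos by simp
  qed
  moreover have "0 < N" using I_nonempty by (auto simp: lessThan_empty_iff)
  ultimately show ?thesis using velocities_vanish_or_converge by metis
qed

lemma continuous_on_velocity: "i < N \<Longrightarrow> continuous_on {0..} (v i)"
  using has_vector_derivative_continuous[OF velocity_equation]
  by (auto simp: continuous_on_eq_continuous_within)

lemma uniform_velocity_limit_iff:
  "(\<forall>i<N. exp_decay (\<lambda>t. v i t - l)) \<longleftrightarrow>
    (\<exists>C rate. rate > 0 \<and> (\<forall>i<N. \<forall>t\<ge>0. norm (v i t - l) \<le> C * exp (- rate * t)))"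
  using exp_decay_uniform_iff[of "{..<N}" "\<lambda>i t. v i t - l"]
  by (simp add: Ball_def continuous_on_velocity continuous_on_diff)

lemma diameter_decay:
  "\<exists>C rate. rate > 0 \<and> (\<forall>t\<ge>0.
    Max {norm (v i t - v j t) | i j. i < N \<and> j < N} \<le> C * exp (- rate * t))"
proof -
  have "exp_decay (\<lambda>t. v i t - v j t)" if "i < N" "j < N" for i j
    using exp_decay_diff[OF velocity_deviation_decay velocity_deviation_decay, OF that]
    by (simp add: deviation_def)
  then have "\<forall>(i, j)\<in>{..<N} \<times> {..<N}. exp_decay (\<lambda>t. v i t - v j t)" by auto
  then obtain C r where "r > 0"
    and difference_le: "\<And>i j t. i < N \<Longrightarrow> j < N \<Longrightarrow> t \<ge> 0 \<Longrightarrow> norm (v i t - v j t) \<le> C * exp (- r * t)"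
    using exp_decay_uniform_iff[of "{..<N} \<times> {..<N}" "\<lambda>(i, j) t. v i t - v j t"]
    by (fastforce simp: continuous_on_velocity continuous_on_diff split_beta)
  have pairs: "{norm (v i t - v j t) | i j. i < N \<and> j < N}
      = (\<lambda>(i, j). norm (v i t - v j t)) ` ({..<N} \<times> {..<N})" for t
    by auto
  have "Max {norm (v i t - v j t) | i j. i < N \<and> j < N} \<le> C * exp (- r * t)" if "t \<ge> 0" for t
    unfolding pairs using I_nonempty difference_le that by (intro Max.boundedI) auto
  with \<open>r > 0\<close> show ?thesis by blast
qed

end

theorem theorem3p3:
  fixes N :: nat and m :: "nat \<Rightarrow> real" and \<sigma> p \<kappa> :: real and \<phi> :: "real \<Rightarrow> real"
    and x v :: "nat \<Rightarrow> real \<Rightarrow> real ^ 'n" and \<theta> :: "nat \<Rightarrow> real \<Rightarrow> real"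
  assumes N: "N \<ge> 1"
    and m_pos: "\<forall>i<N. m i > 0"
    and \<sigma>: "\<sigma> > 0" and p: "p > 0" and \<kappa>: "\<kappa> > 0"
    and \<phi>: "comm_kernel \<phi>"
    and \<phi>_inf: "Inf (\<phi> ` {0..}) > 0"
    and cond: "Inf (\<phi> ` {0..}) * (\<Sum>i<N. m i) > \<sigma> * ((\<Sum>i<N. m i * \<theta> i 0) / (\<Sum>i<N. m i))"
    and \<theta>0: "\<forall>i<N. \<theta> i 0 > 0"
    and sol: "CSF_solution N m \<sigma> p \<kappa> \<phi> x v \<theta>"
  shows "(\<exists>C rate. rate > 0 \<and> (\<forall>t\<ge>0.
            Max {norm (v i t - v j t) | i j. i < N \<and> j < N} \<le> C * exp (- rate * t)))
       \<and> ((\<forall>i<N. (v i \<longlongrightarrow> 0) at_top) \<noteq>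
          (\<exists>vbar :: real ^ 'n.
             norm vbar = ((\<Sum>i<N. m i * \<theta> i 0) / (\<Sum>i<N. m i)) powr (1 / p) \<and>
             (\<exists>C rate. rate > 0 \<and> (\<forall>i<N. \<forall>t\<ge>0. norm (v i t - vbar) \<le> C * exp (- rate * t)))))"
proof -
  interpret weights "{..<N}" m using N m_pos by unfold_locales (auto simp: lessThan_empty_iff)
  have mean: "(\<Sum>i<N. m i * \<theta> i 0) / (\<Sum>i<N. m i) = wmean (\<lambda>i. \<theta> i 0)"
    by (simp add: wmean_def mass_def)
  have "bdd_below (\<phi> ` {0..})"
    using \<phi> by (intro bdd_belowI[of _ 0]) (auto simp: comm_kernel_def less_imp_le)
  then have "Inf (\<phi> ` {0..}) \<le> \<phi> r" if "r \<ge> 0" for r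
    using that by (intro cInf_lower) auto
  then interpret csf N m \<sigma> p \<kappa> "Inf (\<phi> ` {0..})" \<phi> x v \<theta>
    using \<sigma> p \<kappa> \<phi>_inf cond \<theta>0 sol unfolding mean by unfold_locales (auto simp: mass_def)
  show ?thesis
    using diameter_decay velocity_alternative
    unfolding mean \<theta>mean_def uniform_velocity_limit_iff by (rule conjI)
qed

end
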